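(* Let $G$ be an arbitrary group. Then the cube-structure $\mathcal{D}_1(G)$ is a $1$-step groupspace.
   Context: Notation: $[n]=\{1,\dots,n\}$; $\{0,1\}^0$ is a one point set; $1^n$ is the all-one vector; $\{0,1\}^n_*=\{0,1\}^n\setminus\{1^n\}$. $\mathcal{G}$-morphisms: a map $\phi:\{0,1\}^n\to\{0,1\}^m$ is a morphism in $\mathcal{G}$ if for every $i\in[m]$ the function $v\mapsto\phi(v)_i$ is either constant (then put $\gamma_\phi(i)=0$) or equal to $v\mapsto v_j$ or $v\mapsto 1-v_j$ for some $j\in[n]$ (then put $\gamma_\phi(i)=j$), and for all $1\le i<j\le m$ either $\gamma_\phi(j)=0$ or $\gamma_\phi(i)\le\gamma_\phi(j)$. For $i\in[n]$, $j\in\{0,1\}$ the face embedding $e^n_{i,j}:\{0,1\}^{n-1}\to\{0,1\}^n$ is $e^n_{i,j}(x_1,\dots,x_{n-1})=(x_1,\dots,x_{i-1},j,x_i,\dots,x_{n-1})$. A cube-structure is a set $X$ with subsets $C^n(X)\subseteq X^{\{0,1\}^n}$ for $n=0,1,2,\dots$. It is a groupspace if: (presheaf) $\psi\in C^m(X)$ and $\phi:\{0,1\}^n\to\{0,1\}^m$ a morphism in $\mathcal{G}$ imply $\psi\circ\phi\in C^n(X)$; (ergodicity) $C^1(X)=X^{\{0,1\}}$; (completion) for every $n\ge 0$, if $f:\{0,1\}^n_*\to X$ satisfies $f\circ e^n_{i,0}\in C^{n-1}(X)$ for all $i\in[n]$, then some $\phi\in C^n(X)$ restricts to $f$ on $\{0,1\}^n_*$.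 A groupspace is $k$-step if for $n=k+1$ the completion $\phi$ is always uniquely determined by $f$. For a group $G$, $\mathcal{D}_1(G)$ is the cube-structure on the set $G$ for which $C^n(G)$ is the set of all maps $\{0,1\}^n\to G$ of the form $v\mapsto a_0a_1^{v_1}a_2^{v_2}\cdots a_n^{v_n}$ with $a_0,a_1,\dots,a_n\in G$. *)

theory Defs
  imports "HOL-Library.FuncSet" "HOL-Algebra.Group"
begin

text \<open>
  Points of the discrete cube are extensional functions on the coordinate set \<open>{1..n}\<close>,
  so \<open>cube 0\<close> has exactly one element. Likewise, maps between cubes, and maps from a cube to
  a set, are extensional functions, which makes equality of functions the right equality of maps.
\<close>

definition cube :: "nat \<Rightarrow> (nat \<Rightarrow> nat) set" where
  "cube n = {1..n} \<rightarrow>\<^sub>E {0, 1}"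

definition ones :: "nat \<Rightarrow> (nat \<Rightarrow> nat)" where
  "ones n = (\<lambda>i\<in>{1..n}. 1)"

definition punctured_cube :: "nat \<Rightarrow> (nat \<Rightarrow> nat) set" where
  "punctured_cube n = cube n - {ones n}"

text \<open>
  The function \<open>\<gamma>\<close> below is determined by \<open>\<phi>\<close> on \<open>{1..m}\<close>, because a coordinate of \<open>\<phi>\<close> cannot
  be constant and depend on some \<open>v j\<close>, nor depend on two different coordinates. Hence the
  existential quantifier only names it.
\<close>

definition cube_morphism :: "nat \<Rightarrow> nat \<Rightarrow> ((nat \<Rightarrow> nat) \<Rightarrow> (nat \<Rightarrow> nat)) \<Rightarrow> bool" where
  "cube_morphism n m \<phi> \<longleftrightarrow>
     \<phi> \<in> cube n \<rightarrow>\<^sub>E cube m \<and>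
     (\<exists>\<gamma> :: nat \<Rightarrow> nat.
        (\<forall>i\<in>{1..m}.
            (\<gamma> i = 0 \<and> (\<exists>c. \<forall>v\<in>cube n. \<phi> v i = c)) \<or>
            (\<gamma> i \<in> {1..n} \<and>
              ((\<forall>v\<in>cube n. \<phi> v i = v (\<gamma> i)) \<or> (\<forall>v\<in>cube n. \<phi> v i = 1 - v (\<gamma> i))))) \<and>
        (\<forall>i\<in>{1..m}. \<forall>j\<in>{1..m}. i < j \<longrightarrow> \<gamma> j = 0 \<or> \<gamma> i \<le> \<gamma> j))"

definition face :: "nat \<Rightarrow> nat \<Rightarrow> nat \<Rightarrow> (nat \<Rightarrow> nat) \<Rightarrow> (nat \<Rightarrow> nat)" where
  "face n i j = (\<lambda>x\<in>cube (n - 1). \<lambda>l\<in>{1..n}.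
     if l < i then x l else if l = i then j else x (l - 1))"

locale cube_structure =
  fixes X :: "'a set" and C :: "nat \<Rightarrow> ((nat \<Rightarrow> nat) \<Rightarrow> 'a) set"
  assumes cubes_subset: "C n \<subseteq> cube n \<rightarrow>\<^sub>E X"

definition corner :: "'a set \<Rightarrow> (nat \<Rightarrow> ((nat \<Rightarrow> nat) \<Rightarrow> 'a) set) \<Rightarrow> nat \<Rightarrow> ((nat \<Rightarrow> nat) \<Rightarrow> 'a) \<Rightarrow> bool" where
  "corner X C n f \<longleftrightarrow>
     f \<in> punctured_cube n \<rightarrow>\<^sub>E X \<and>
     (\<forall>i\<in>{1..n}. compose (cube (n - 1)) f (face n i 0) \<in> C (n - 1))"

definition completion :: "(nat \<Rightarrow> ((nat \<Rightarrow> nat) \<Rightarrow> 'a) set) \<Rightarrow> nat \<Rightarrow> ((nat \<Rightarrow> nat) \<Rightarrow> 'a) \<Rightarrow> ((nat \<Rightarrow> nat) \<Rightarrow> 'a) \<Rightarrow> bool" where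
  "completion C n f \<phi> \<longleftrightarrow> \<phi> \<in> C n \<and> restrict \<phi> (punctured_cube n) = f"

locale groupspace = cube_structure X C
  for X :: "'a set" and C :: "nat \<Rightarrow> ((nat \<Rightarrow> nat) \<Rightarrow> 'a) set" +
  assumes presheaf: "\<psi> \<in> C m \<Longrightarrow> cube_morphism n m \<phi> \<Longrightarrow> compose (cube n) \<psi> \<phi> \<in> C n"
    and ergodicity: "C 1 = cube 1 \<rightarrow>\<^sub>E X"
    and completion: "corner X C n f \<Longrightarrow> \<exists>\<phi>. completion C n f \<phi>"

locale step_groupspace = groupspace X C
  for k :: nat and X :: "'a set" and C :: "nat \<Rightarrow> ((nat \<Rightarrow> nat) \<Rightarrow> 'a) set" +
  assumes unique_completion: "corner X C (k + 1) f \<Longrightarrow> \<exists>!\<phi>. completion C (k + 1) f \<phi>"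

text \<open>
  \<open>ordered_prod G a v n\<close> is \<open>a 0 \<otimes> a 1 [^] v 1 \<otimes> \<dots> \<otimes> a n [^] v n\<close>, in this order; the library's
  finite products are for commutative monoids only.
\<close>

primrec ordered_prod :: "('a, 'b) monoid_scheme \<Rightarrow> (nat \<Rightarrow> 'a) \<Rightarrow> (nat \<Rightarrow> nat) \<Rightarrow> nat \<Rightarrow> 'a" where
  "ordered_prod G a v 0 = a 0"
| "ordered_prod G a v (Suc n) = ordered_prod G a v n \<otimes>\<^bsub>G\<^esub> (a (Suc n) [^]\<^bsub>G\<^esub> v (Suc n))"

definition D1 :: "('a, 'b) monoid_scheme \<Rightarrow> nat \<Rightarrow> ((nat \<Rightarrow> nat) \<Rightarrow> 'a) set" where
  "D1 G n = {(\<lambda>v\<in>cube n. ordered_prod G a v n) | a. a \<in> {0..n} \<rightarrow> carrier G}"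

end

theory Submission
  imports Defs
begin

text \<open>
  A map \<open>f\<close> on the cube belongs to \<open>D1 G\<close> iff for every splitting of a point into an initial part
  \<open>x\<close> and a final part \<open>y\<close> the quotient of \<open>f (x, y)\<close> and \<open>f (x, y')\<close> does not depend on \<open>x\<close>: the
  common initial factors of the two ordered products cancel. Monotonicity of \<open>\<gamma>\<close> means that
  cube morphisms pull splittings back to splittings, which gives the presheaf axiom. A corner is
  completed by reading off all coefficients but the last on the face where the last coordinate
  vanishes; every other point of the punctured cube lies on a further face, whose splitting
  condition yields the value predicted by the last coefficient.
\<close>

section \<open>Points of the cube and its faces\<close>

lemma cube_ext: "v \<in> cube n \<Longrightarrow> w \<in> cube n \<Longrightarrow> (\<And>i. i \<in> {1..n} \<Longrightarrow> v i = w i) \<Longrightarrow> v = w"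
  unfolding cube_def by (rule PiE_ext)

lemma restrict_in_cube: "(\<And>i. 1 \<le> i \<Longrightarrow> i \<le> n \<Longrightarrow> v i = 0 \<or> v i = 1) \<Longrightarrow> restrict v {1..n} \<in> cube n"
  unfolding cube_def by auto

lemma cube_coord: "v \<in> cube n \<Longrightarrow> 1 \<le> i \<Longrightarrow> i \<le> n \<Longrightarrow> v i = 0 \<or> v i = 1"
  unfolding cube_def by auto

text \<open>Deleting coordinate \<open>i\<close> recovers the preimage of \<open>v\<close> under the
  embedding \<open>face n i 0\<close> when \<open>v i = 0\<close>. Thus a value of a corner at
  \<open>v\<close> becomes a value of one of its faces.\<close>

definition unface :: "nat \<Rightarrow> nat \<Rightarrow> (nat \<Rightarrow> nat) \<Rightarrow> nat \<Rightarrow> nat" where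
  "unface n i v = (\<lambda>l\<in>{1..n - 1}. if l < i then v l else v (Suc l))"

lemma unface_in_cube: "v \<in> cube n \<Longrightarrow> unface n i v \<in> cube (n - 1)"
  unfolding unface_def
  by (rule restrict_in_cube) (simp add: cube_coord[simplified])

lemma face_unface:
  assumes "v \<in> cube n" "i \<in> {1..n}" "v i = 0"
  shows "face n i 0 (unface n i v) = v"
proof (rule extensionalityI)
  show "face n i 0 (unface n i v) \<in> extensional {1..n}"
    using unface_in_cube[OF assms(1)] by (simp add: face_def)
  show "v \<in> extensional {1..n}"
    using assms(1) by (auto simp: cube_def PiE_def)
next
  fix l assume "l \<in> {1..n}"
  then show "face n i 0 (unface n i v) l = v l"
    using unface_in_cube[OF assms(1)] assms by (auto simp: face_def unface_def)
qed

section \<open>Ordered products and the splitting condition\<close>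

lemma ordered_prod_cong:
  "(\<And>i. i \<le> n \<Longrightarrow> a i = b i) \<Longrightarrow> (\<And>i. i \<in> {1..n} \<Longrightarrow> v i = w i)
    \<Longrightarrow> ordered_prod G a v n = ordered_prod G b w n"
  by (induction n) auto

text \<open>Cut each point after coordinate \<open>k\<close> and read \<open>v = (x, y)\<close>,
  \<open>w = (x, y')\<close>, \<open>v' = (x', y)\<close>, \<open>w' = (x', y')\<close>. For
  \<open>k = 0\<close> this forces \<open>v = v'\<close> and \<open>w = w'\<close>; for
  \<open>k \<ge> n\<close> it forces \<open>v = w\<close> and \<open>v' = w'\<close>.\<close>

definition splits :: "('a, 'b) monoid_scheme \<Rightarrow> nat \<Rightarrow> ((nat \<Rightarrow> nat) \<Rightarrow> 'a) \<Rightarrow> bool" where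
  "splits G n f \<longleftrightarrow> (\<forall>k. \<forall>v\<in>cube n. \<forall>w\<in>cube n. \<forall>v'\<in>cube n. \<forall>w'\<in>cube n.
     (\<forall>i\<in>{1..n}. if i \<le> k then v i = w i \<and> v' i = w' i else v i = v' i \<and> w i = w' i)
      \<longrightarrow> inv\<^bsub>G\<^esub> f v \<otimes>\<^bsub>G\<^esub> f w = inv\<^bsub>G\<^esub> f v' \<otimes>\<^bsub>G\<^esub> f w')"

lemma splitsD:
  assumes "splits G n f" "v \<in> cube n" "w \<in> cube n" "v' \<in> cube n" "w' \<in> cube n"
    and "\<And>i. i \<in> {1..n} \<Longrightarrow> i \<le> k \<Longrightarrow> v i = w i \<and> v' i = w' i"
    and "\<And>i. i \<in> {1..n} \<Longrightarrow> k < i \<Longrightarrow> v i = v' i \<and> w i = w' i"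
  shows "inv\<^bsub>G\<^esub> f v \<otimes>\<^bsub>G\<^esub> f w = inv\<^bsub>G\<^esub> f v' \<otimes>\<^bsub>G\<^esub> f w'"
  using assms(1)[unfolded splits_def, rule_format, OF assms(2-5), of k] assms(6,7)
  by (simp add: not_le)

context group
begin

lemma ordered_prod_closed:
  "a \<in> {0..n} \<rightarrow> carrier G \<Longrightarrow> ordered_prod G a v n \<in> carrier G"
  by (induction n) (auto simp: Pi_def)

text \<open>Induction on the number of factors. If even the last coordinate lies in the common
  initial part, both quotients are trivial. Otherwise the last factors surround the shorter
  quotient, and they depend only on the final part.\<close>

lemma ordered_prod_splits:
  assumes "a \<in> {0..n} \<rightarrow> carrier G"
    and "\<forall>i\<in>{1..n}. if i \<le> k then v i = w i \<and> v' i = w' i else v i = v' i \<and> w i = w' i"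
  shows "inv (ordered_prod G a v n) \<otimes> ordered_prod G a w n
       = inv (ordered_prod G a v' n) \<otimes> ordered_prod G a w' n"
  using assms
proof (induction n)
  case 0
  then show ?case by auto
next
  case (Suc n)
  have a: "a \<in> {0..n} \<rightarrow> carrier G" and an: "a (Suc n) \<in> carrier G"
    using Suc.prems(1) by auto
  show ?case
  proof (cases "Suc n \<le> k")
    case True
    have "ordered_prod G a v (Suc n) = ordered_prod G a w (Suc n)"
      "ordered_prod G a v' (Suc n) = ordered_prod G a w' (Suc n)"
      by (rule ordered_prod_cong; use Suc.prems(2) True in \<open>auto split: if_splits\<close>)+
    then show ?thesis
      using ordered_prod_closed[OF Suc.prems(1)] by (metis l_inv)
  next
    case False
    have IH: "inv (ordered_prod G a v n) \<otimes> ordered_prod G a w n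
       = inv (ordered_prod G a v' n) \<otimes> ordered_prod G a w' n"
      using Suc.IH[OF a] Suc.prems(2) by auto
    have eq: "v (Suc n) = v' (Suc n)" "w (Suc n) = w' (Suc n)"
      using Suc.prems(2) False by (auto split: if_splits)
    have rearrange: "inv (p \<otimes> s) \<otimes> (q \<otimes> t) = inv s \<otimes> (inv p \<otimes> q) \<otimes> t"
      if "p \<in> carrier G" "q \<in> carrier G" "s \<in> carrier G" "t \<in> carrier G" for p q s t
      using that by (simp add: inv_mult_group m_assoc)
    show ?thesis
      using ordered_prod_closed[OF a] an by (simp add: rearrange IH eq)
  qed
qed

text \<open>For the converse, the coefficients are forced by the values of \<open>f\<close> at the
  origin and at the unit vectors. Induction over the truncations of a point shows that they
  reproduce \<open>f\<close>.\<close>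

lemma D1_iff: "f \<in> D1 G n \<longleftrightarrow> f \<in> cube n \<rightarrow>\<^sub>E carrier G \<and> splits G n f"
proof
  assume "f \<in> D1 G n"
  then obtain a where f: "f = (\<lambda>v\<in>cube n. ordered_prod G a v n)"
    and a: "a \<in> {0..n} \<rightarrow> carrier G"
    unfolding D1_def by auto
  show "f \<in> cube n \<rightarrow>\<^sub>E carrier G \<and> splits G n f"
    using ordered_prod_closed[OF a] ordered_prod_splits[OF a] by (auto simp: f splits_def)
next
  assume asm: "f \<in> cube n \<rightarrow>\<^sub>E carrier G \<and> splits G n f"
  then have f: "\<And>v. v \<in> cube n \<Longrightarrow> f v \<in> carrier G" and s: "splits G n f" by auto
  define z where "z = restrict (\<lambda>i. 0::nat) {1..n}"
  define e where "e j = restrict (\<lambda>i. if i = j then 1 else 0::nat) {1..n}" for j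
  define t where "t v j = restrict (\<lambda>i. if i \<le> j then v i else 0::nat) {1..n}" for v j
  define a where "a j = (if j = 0 then f z else inv (f z) \<otimes> f (e j))" for j
  have mem: "z \<in> cube n" "e j \<in> cube n" "v \<in> cube n \<Longrightarrow> t v j \<in> cube n" for v j
    unfolding z_def e_def t_def by (rule restrict_in_cube, simp add: cube_coord[simplified])+
  have a: "a \<in> {0..n} \<rightarrow> carrier G"
    using f mem by (auto simp: a_def)
  have "ordered_prod G a v j = f (t v j)" if v: "v \<in> cube n" and "j \<le> n" for v j
    using \<open>j \<le> n\<close>
  proof (induction j)
    case 0
    have "t v 0 = z" by (auto simp: t_def z_def)
    then show ?case by (simp add: a_def)
  next
    case (Suc j)
    have IH: "ordered_prod G a v j = f (t v j)" using Suc by simp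
    have "v (Suc j) = 0 \<or> v (Suc j) = 1" by (rule cube_coord[OF v]) (use Suc.prems in auto)
    then show ?case
    proof
      assume 0: "v (Suc j) = 0"
      then have "t v (Suc j) = t v j" by (auto simp: t_def le_Suc_eq)
      then show ?thesis using 0 IH f mem v by simp
    next
      assume 1: "v (Suc j) = 1"
      \<comment> \<open>Cutting after \<open>j\<close>, all four points are zero beyond the cut,
        except that \<open>e (Suc j)\<close> and \<open>t v (Suc j)\<close> have a 1 at
        \<open>Suc j\<close>. Before the cut, \<open>z\<close> and \<open>e (Suc j)\<close> vanish
        while both truncations agree with \<open>v\<close>.\<close>
      have "inv (f z) \<otimes> f (e (Suc j)) = inv (f (t v j)) \<otimes> f (t v (Suc j))"
        by (rule splitsD[OF s mem(1,2) mem(3,3)[OF v], where k = j]) (use 1 in \<open>auto simp: z_def e_def t_def le_Suc_eq\<close>)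
      then have "f (t v j) \<otimes> a (Suc j) = f (t v (Suc j))"
        using f mem v by (simp add: a_def m_assoc[symmetric])
      moreover have "a (Suc j) \<in> carrier G" using a Suc.prems by auto
      ultimately show ?thesis using 1 IH by simp
    qed
  qed
  moreover have "t v n = v" if "v \<in> cube n" for v
    by (rule cube_ext) (use that mem in \<open>auto simp: t_def\<close>)
  ultimately have "f = (\<lambda>v\<in>cube n. ordered_prod G a v n)"
    using asm by (intro extensionalityI[of f "cube n"]) (auto simp: PiE_def)
  then show "f \<in> D1 G n" using a unfolding D1_def by auto
qed

section \<open>The presheaf, ergodicity and completion axioms\<close>

lemma D1_presheaf:
  assumes \<psi>: "\<psi> \<in> D1 G m" and \<phi>: "cube_morphism n m \<phi>"
  shows "compose (cube n) \<psi> \<phi> \<in> D1 G n"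
proof -
  have \<phi>_mem: "\<phi> v \<in> cube m" if "v \<in> cube n" for v
    using \<phi> that by (auto simp: cube_morphism_def)
  obtain \<gamma> where coord: "\<forall>i\<in>{1..m}.
            (\<gamma> i = 0 \<and> (\<exists>c. \<forall>v\<in>cube n. \<phi> v i = c)) \<or>
            (\<gamma> i \<in> {1..n} \<and>
              ((\<forall>v\<in>cube n. \<phi> v i = v (\<gamma> i)) \<or> (\<forall>v\<in>cube n. \<phi> v i = 1 - v (\<gamma> i))))"
    and mono: "\<forall>i\<in>{1..m}. \<forall>j\<in>{1..m}. i < j \<longrightarrow> \<gamma> j = 0 \<or> \<gamma> i \<le> \<gamma> j"
    using \<phi> unfolding cube_morphism_def by (elim conjE exE) (rule that)
  have \<phi>_eq: "\<phi> v i = \<phi> w i"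
    if "i \<in> {1..m}" "v \<in> cube n" "w \<in> cube n" "\<gamma> i \<noteq> 0 \<Longrightarrow> \<gamma> i \<in> {1..n} \<Longrightarrow> v (\<gamma> i) = w (\<gamma> i)" for v w i
    using bspec[OF coord that(1)] that(2-4) by auto
  have "splits G n (compose (cube n) \<psi> \<phi>)"
    unfolding splits_def
  proof (intro allI ballI impI)
    fix k v w v' w'
    assume mem: "v \<in> cube n" "w \<in> cube n" "v' \<in> cube n" "w' \<in> cube n"
      and split: "\<forall>i\<in>{1..n}. if i \<le> k then v i = w i \<and> v' i = w' i else v i = v' i \<and> w i = w' i"
    \<comment> \<open>The cut in the target lies after the last coordinate that reads one of the
      first \<open>k\<close> source coordinates, or at 0 if there is none. By monotonicity no
      coordinate up to \<open>l\<close> reads beyond \<open>k\<close>; constant coordinates may lie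
      on either side.\<close>
    define l where "l = Max (insert 0 {i \<in> {1..m}. 1 \<le> \<gamma> i \<and> \<gamma> i \<le> k})"
    have l_ge: "i \<le> l" if "i \<in> {1..m}" "1 \<le> \<gamma> i" "\<gamma> i \<le> k" for i
      unfolding l_def using that by (intro Max_ge) auto
    have l_mem: "l \<in> insert 0 {i \<in> {1..m}. 1 \<le> \<gamma> i \<and> \<gamma> i \<le> k}"
      unfolding l_def by (rule Max_in) auto
    have low: "\<gamma> i \<le> k" if "i \<in> {1..m}" "i \<le> l" for i
      using l_mem mono[rule_format, of i l] that by (cases "i = l") auto
    have high: "\<gamma> i = 0 \<or> k < \<gamma> i" if "i \<in> {1..m}" "l < i" for i
      using l_ge[of i] that by linarith
    have "inv \<psi> (\<phi> v) \<otimes> \<psi> (\<phi> w) = inv \<psi> (\<phi> v') \<otimes> \<psi> (\<phi> w')"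
    proof (rule splitsD[OF _ \<phi>_mem[OF mem(1)] \<phi>_mem[OF mem(2)] \<phi>_mem[OF mem(3)] \<phi>_mem[OF mem(4)],
          where f = \<psi> and k = l])
      show "splits G m \<psi>" using \<psi> D1_iff by blast
    next
      fix i assume i: "i \<in> {1..m}" "i \<le> l"
      show "\<phi> v i = \<phi> w i \<and> \<phi> v' i = \<phi> w' i"
        using \<phi>_eq[OF i(1) mem(1,2)] \<phi>_eq[OF i(1) mem(3,4)] low[OF i] split by simp
    next
      fix i assume i: "i \<in> {1..m}" "l < i"
      show "\<phi> v i = \<phi> v' i \<and> \<phi> w i = \<phi> w' i"
        using \<phi>_eq[OF i(1) mem(1,3)] \<phi>_eq[OF i(1) mem(2,4)] high[OF i] split by auto
    qed
    then show "inv compose (cube n) \<psi> \<phi> v \<otimes> compose (cube n) \<psi> \<phi> w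
        = inv compose (cube n) \<psi> \<phi> v' \<otimes> compose (cube n) \<psi> \<phi> w'"
      using mem by (simp add: compose_eq)
  qed
  moreover have "compose (cube n) \<psi> \<phi> \<in> cube n \<rightarrow>\<^sub>E carrier G"
    using \<psi> \<phi>_mem by (auto simp: D1_iff compose_def)
  ultimately show ?thesis by (simp add: D1_iff)
qed

text \<open>With a single coordinate one of the two parts of any splitting is empty, so every map
  splits.\<close>

lemma D1_1: "D1 G 1 = cube 1 \<rightarrow>\<^sub>E carrier G"
proof -
  have "splits G 1 f" if "f \<in> cube 1 \<rightarrow>\<^sub>E carrier G" for f
    unfolding splits_def
  proof (intro allI ballI impI)
    fix k v w v' w'
    assume mem: "v \<in> cube 1" "w \<in> cube 1" "v' \<in> cube 1" "w' \<in> cube 1"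
      and "\<forall>i\<in>{1..1}. if i \<le> k then v i = w i \<and> v' i = w' i else v i = v' i \<and> w i = w' i"
    then have "v = w \<and> v' = w' \<or> v = v' \<and> w = w'"
      by (cases "1 \<le> k") (auto intro!: cube_ext)
    then show "inv f v \<otimes> f w = inv f v' \<otimes> f w'"
      using that mem by (auto simp: PiE_iff)
  qed
  then show ?thesis by (auto simp: D1_iff)
qed

lemma D1_completion:
  assumes "corner (carrier G) (D1 G) n f"
  shows "\<exists>\<phi>. completion (D1 G) n f \<phi>"
\<comment> \<open>The 0-dimensional cube has no faces to read coefficients from, and its punctured
  cube is empty, so any element of \<open>D1 G 0\<close> is a completion.\<close>
proof (cases "n = 0")
  case True
  have "punctured_cube 0 = {}"
    by (auto simp: punctured_cube_def cube_def ones_def)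
  then have "restrict \<phi> (punctured_cube n) = f" for \<phi>
    using assms True by (auto simp: corner_def)
  moreover have "(\<lambda>v\<in>cube n. ordered_prod G (\<lambda>_. \<one>) v n) \<in> D1 G n"
    unfolding D1_def by blast
  ultimately show ?thesis unfolding completion_def by blast
next
  case False
  have f: "\<And>v. v \<in> punctured_cube n \<Longrightarrow> f v \<in> carrier G"
    and f_ext: "f \<in> extensional (punctured_cube n)"
    and faces: "\<And>i. i \<in> {1..n} \<Longrightarrow> compose (cube (n - 1)) f (face n i 0) \<in> D1 G (n - 1)"
    using assms by (auto simp: corner_def PiE_def)
  obtain a where a: "a \<in> {0..n - 1} \<rightarrow> carrier G"
    and last_face: "compose (cube (n - 1)) f (face n n 0) = (\<lambda>v\<in>cube (n - 1). ordered_prod G a v (n - 1))"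
    using faces[of n] False unfolding D1_def by auto
  define z where "z = restrict (\<lambda>i. 0::nat) {1..n}"
  define e where "e = restrict (\<lambda>i. if i = n then 1 else 0::nat) {1..n}"
  \<comment> \<open>The last coefficient must be the quotient of the values at the last unit vector
    and the origin. For \<open>n = 1\<close> that unit vector is the missing point
    \<open>ones 1\<close>, so \<open>\<one>\<close> is chosen instead.\<close>
  define b where "b = (if n = 1 then \<one> else inv (f z) \<otimes> f e)"
  define \<phi> where "\<phi> = (\<lambda>v\<in>cube n. ordered_prod G (a(n := b)) v n)"
  have mem: "z \<in> cube n" "e \<in> cube n"
    unfolding z_def e_def by (rule restrict_in_cube, simp)+
  have punctured: "v \<in> punctured_cube n" if "v \<in> cube n" "i \<in> {1..n}" "v i = 0" for v i
    using that by (auto simp: punctured_cube_def ones_def)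
  have b: "b \<in> carrier G"
    using False f[OF punctured[OF mem(1), of 1]] f[OF punctured[OF mem(2), of 1]]
    by (auto simp: b_def z_def e_def)
  have "(a(n := b)) \<in> {0..n} \<rightarrow> carrier G"
    using a b by (auto simp: Pi_def)
  then have "\<phi> \<in> D1 G n" unfolding D1_def \<phi>_def by blast
  have \<phi>_last: "\<phi> v = ordered_prod G a v (n - 1) \<otimes> b [^] v n" if "v \<in> cube n" for v
  proof -
    obtain m where m: "n = Suc m" using False not0_implies_Suc by blast
    have "ordered_prod G (a(n := b)) v m = ordered_prod G a v m"
      by (rule ordered_prod_cong) (auto simp: m)
    then show ?thesis using that by (simp add: \<phi>_def m)
  qed
  have on_last_face: "ordered_prod G a v (n - 1) = f v" if v: "v \<in> cube n" "v n = 0" for v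
  proof -
    have "f v = compose (cube (n - 1)) f (face n n 0) (unface n n v)"
      using face_unface[of v n n] v False unface_in_cube[of v n n] by (simp add: compose_eq)
    also have "\<dots> = ordered_prod G a (unface n n v) (n - 1)"
      unfolding last_face using v unface_in_cube[of v n n] by simp
    also have "\<dots> = ordered_prod G a v (n - 1)"
      by (rule ordered_prod_cong) (auto simp: unface_def)
    finally show ?thesis by simp
  qed
  have "\<phi> v = f v" if v: "v \<in> punctured_cube n" for v
  proof -
    have vc: "v \<in> cube n" using v by (simp add: punctured_cube_def)
    consider "v n = 0" | "v n = 1" using cube_coord[OF vc, of n] False by auto
    then show ?thesis
    proof cases
      case 1
      then show ?thesis using on_last_face[OF vc] f[OF v] by (simp add: \<phi>_last[OF vc])
    next
      case 2
      have "\<exists>i\<in>{1..n}. v i \<noteq> 1"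
      proof (rule ccontr)
        assume "\<not> ?thesis"
        then have "v = ones n"
          using vc by (intro cube_ext) (auto simp: ones_def cube_def)
        then show False using v by (simp add: punctured_cube_def)
      qed
      then obtain i where i: "i \<in> {1..n}" "v i = 0" using cube_coord[OF vc] by force
      then have "i < n" using 2 by (cases "i = n") auto
      \<comment> \<open>Projecting \<open>v\<close> to the last face gives a point where
        \<open>f\<close> is already known. Since \<open>i < n\<close>, the points \<open>u\<close>,
        \<open>v\<close>, \<open>z\<close> and \<open>e\<close> all lie on the face of coordinate
        \<open>i\<close>, so its splitting condition relates them.\<close>
      define u where "u = restrict (v(n := 0)) {1..n}"
      have "u \<in> cube n"
        unfolding u_def using vc by (intro restrict_in_cube) (simp add: cube_coord[simplified])
      then have u: "u \<in> cube n" "u n = 0" "u i = 0"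
        using i by (auto simp: u_def)
      have ze: "z i = 0" "e i = 0" using i \<open>i < n\<close> by (auto simp: z_def e_def)
      define g where "g = compose (cube (n - 1)) f (face n i 0)"
      have g: "g (unface n i x) = f x" if "x \<in> cube n" "x i = 0" for x
        using face_unface[OF that(1) i(1) that(2)] unface_in_cube[OF that(1)]
        by (simp add: g_def compose_eq)
      have "splits G (n - 1) g" using faces[OF i(1)] by (simp add: D1_iff g_def)
      then have "inv (g (unface n i u)) \<otimes> g (unface n i v)
          = inv (g (unface n i z)) \<otimes> g (unface n i e)"
        \<comment> \<open>Deleting coordinate \<open>i\<close> moves the last coordinate to position
          \<open>n - 1\<close>, so the cut that isolates it is after \<open>n - 2\<close>.\<close>
        by (rule splitsD[OF _ unface_in_cube[OF u(1)] unface_in_cube[OF vc]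
              unface_in_cube[OF mem(1)] unface_in_cube[OF mem(2)], where k = "n - 2"])
          (use 2 \<open>i < n\<close> in \<open>auto simp: unface_def u_def z_def e_def\<close>)
      then have "inv (f u) \<otimes> f v = b"
        using g mem u vc i ze \<open>i < n\<close> by (simp add: b_def)
      moreover have "ordered_prod G a v (n - 1) = ordered_prod G a u (n - 1)"
        by (rule ordered_prod_cong) (auto simp: u_def)
      moreover have "f u \<in> carrier G" using f punctured[OF u(1) i(1) u(3)] .
      ultimately show ?thesis
        using on_last_face[OF u(1,2)] f[OF v] b 2
        by (simp add: \<phi>_last[OF vc] m_assoc[symmetric] flip: \<open>inv (f u) \<otimes> f v = b\<close>)
    qed
  qed
  then have "restrict \<phi> (punctured_cube n) = f"
    using f_ext by (intro extensionalityI[of _ "punctured_cube n"]) auto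
  then show ?thesis using \<open>\<phi> \<in> D1 G n\<close> unfolding completion_def by blast
qed

section \<open>Uniqueness of completions of squares\<close>

lemma D1_2_unique:
  assumes \<phi>: "\<phi> \<in> D1 G 2" and \<phi>': "\<phi>' \<in> D1 G 2"
    and eq: "restrict \<phi> (punctured_cube 2) = restrict \<phi>' (punctured_cube 2)"
  shows "\<phi> = \<phi>'"
proof -
  define p where "p x y = restrict (\<lambda>i. if i = 1 then x else y) {1..2::nat}" for x y :: nat
  have p: "p x y \<in> cube 2" if "x \<in> {0,1}" "y \<in> {0,1}" for x y
    unfolding p_def using that by (intro restrict_in_cube) auto
  \<comment> \<open>Splitting a square after its first coordinate expresses the value at the top
    vertex through the other three, all of which lie in the punctured square.\<close>
  have top: "\<psi> (p 1 1) = \<psi> (p 1 0) \<otimes> (inv \<psi> (p 0 0) \<otimes> \<psi> (p 0 1))" if \<psi>: "\<psi> \<in> D1 G 2" for \<psi>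
  proof -
    have c: "\<psi> v \<in> carrier G" if "v \<in> cube 2" for v
      using \<psi> that by (auto simp: D1_iff)
    have "splits G 2 \<psi>" using \<psi> by (simp add: D1_iff)
    then have "inv \<psi> (p 1 0) \<otimes> \<psi> (p 1 1) = inv \<psi> (p 0 0) \<otimes> \<psi> (p 0 1)"
      by (rule splitsD[where k = 1]) (auto simp: p intro!: p, auto simp: p_def)
    moreover have "\<psi> (p 1 1) = \<psi> (p 1 0) \<otimes> (inv \<psi> (p 1 0) \<otimes> \<psi> (p 1 1))"
      using c p by (simp add: m_assoc[symmetric])
    ultimately show ?thesis by simp
  qed
  have eq_at: "\<phi> v = \<phi>' v" if "v \<in> punctured_cube 2" for v
    using fun_cong[OF eq, of v] that by simp
  have "ones 2 = p 1 1" by (auto simp: ones_def p_def)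
  moreover have "p x y \<in> punctured_cube 2" if "x \<in> {0,1}" "y \<in> {0,1}" "x = 0 \<or> y = 0" for x y
  proof -
    have "p x y 1 \<noteq> ones 2 1 \<or> p x y 2 \<noteq> ones 2 2"
      using that by (auto simp: ones_def p_def)
    then show ?thesis using p[OF that(1,2)] by (auto simp: punctured_cube_def)
  qed
  ultimately have "\<phi> (ones 2) = \<phi>' (ones 2)"
    using top[OF \<phi>] top[OF \<phi>'] eq_at by simp
  then have "\<phi> v = \<phi>' v" if "v \<in> cube 2" for v
    using eq_at[of v] that by (cases "v = ones 2") (auto simp: punctured_cube_def)
  then show ?thesis
    using \<phi> \<phi>' by (intro PiE_ext[of \<phi> "cube 2" "\<lambda>_. carrier G"]) (auto simp: D1_iff)
qed

end

theorem theorem8p4: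
  fixes G :: "('a, 'b) monoid_scheme"
  assumes "group G"
  shows "step_groupspace 1 (carrier G) (D1 G)"
proof -
  interpret group G by fact
  show ?thesis
  proof
    show "D1 G n \<subseteq> cube n \<rightarrow>\<^sub>E carrier G" for n
      by (auto simp: D1_iff)
  next
    fix f assume "corner (carrier G) (D1 G) (1 + 1) f"
    from D1_completion[OF this] show "\<exists>!\<phi>. completion (D1 G) (1 + 1) f \<phi>"
      using D1_2_unique unfolding completion_def one_add_one by blast
  qed (use D1_presheaf D1_1 D1_completion in auto)
qed

end
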